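(* Let $n\ge 2$ be an integer and let $f_1,f_2,f_3,\dots$ be independent random functions, each uniformly distributed over the $n^n$ functions from $[n]=\{1,\dots,n\}$ to $[n]$. Put $g_1=f_1$ and $g_t=f_t\circ g_{t-1}$ for $t>1$. For $m\ge 1$ let $\tau_m=|\{t\ge 1: |\mathrm{Range}(g_t)|=m\}|$. Let $\xi=\lfloor \log\log n\rfloor$, $T_1=\sum_{m=2}^{\xi}\tau_m$, and let $\mathcal A=\bigcap_{m=1}^{\xi}[\tau_m>0]$ be the event that $\tau_m>0$ for every $m\in\{1,\dots,\xi\}$. For $k\ge 1$ let $\lambda_k=\prod_{j=1}^{k-1}\left(1-\frac{j}{n}\right)$. Then, for every real $t$ (whenever $\Pr(\mathcal A)>0$ so that the conditional expectation is defined), $$E\left(e^{itT_1}\,\middle|\,\mathcal A\right)=e^{it(\xi-1)}\prod_{k=2}^{\xi}\frac{1-\lambda_k}{1-\lambda_k e^{it}}.$$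
   Context: $i$ denotes the imaginary unit. $\mathrm{Range}(g)$ is the image set of a function $g$.
   Formalization: The formal theorem also assumes ξ ≥ 1 (i.e. n ≥ 16): for 2 ≤ n ≤ 15 one has ξ ≤ 0, so T_1 = 0 and A is certain, the left side is 1 while the right side is e^{it(ξ-1)} ≠ 1 in general, so the claim fails there. *)

theory Defs
  imports "HOL-Probability.Probability"
begin

abbreviation self_maps :: "nat \<Rightarrow> (nat \<Rightarrow> nat) set"
  where "self_maps n \<equiv> {1..n} \<rightarrow>\<^sub>E {1..n}"

text \<open>The sequence of compositions is indexed from 1, as is \<open>\<phi>\<close>; the value at 0 is never used.\<close>

fun g :: "nat \<Rightarrow> (nat \<Rightarrow> nat \<Rightarrow> nat) \<Rightarrow> nat \<Rightarrow> nat \<Rightarrow> nat" where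
  "g n \<phi> 0 = (\<lambda>x\<in>{1..n}. x)"
| "g n \<phi> (Suc 0) = \<phi> 1"
| "g n \<phi> (Suc (Suc t)) = compose {1..n} (\<phi> (Suc (Suc t))) (g n \<phi> (Suc t))"

text \<open>Counting measure rather than \<open>card\<close>: the set of times may be infinite (almost surely it is
  for \<open>m = 1\<close>), in which case the value must be \<open>\<infinity>\<close> and not 0.\<close>

definition \<tau> :: "nat \<Rightarrow> (nat \<Rightarrow> nat \<Rightarrow> nat) \<Rightarrow> nat \<Rightarrow> ennreal"
  where "\<tau> n \<phi> m = emeasure (count_space UNIV) {t. 1 \<le> t \<and> card (g n \<phi> t ` {1..n}) = m}"

definition \<xi> :: "nat \<Rightarrow> int"
  where "\<xi> n = \<lfloor>ln (ln (real n))\<rfloor>"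

definition T\<^sub>1 :: "nat \<Rightarrow> (nat \<Rightarrow> nat \<Rightarrow> nat) \<Rightarrow> ennreal"
  where "T\<^sub>1 n \<phi> = (\<Sum>m = 2..nat (\<xi> n). \<tau> n \<phi> m)"

definition all_visited :: "'a measure \<Rightarrow> nat \<Rightarrow> (nat \<Rightarrow> 'a \<Rightarrow> nat \<Rightarrow> nat) \<Rightarrow> 'a set"
  where "all_visited M n f = {\<omega> \<in> space M. \<forall>m\<in>{1..nat (\<xi> n)}. \<tau> n (\<lambda>t. f t \<omega>) m > 0}"

definition lam :: "nat \<Rightarrow> nat \<Rightarrow> real"
  where "lam n k = (\<Prod>j = 1..<k. 1 - real j / real n)"

text \<open>Elementary conditional expectation given an event \<open>A\<close> of positive probability:
  \<open>uniform_measure M A\<close> is the conditional measure \<open>B \<mapsto> P (A \<inter> B) / P A\<close>.\<close>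

definition expectation_given :: "'a measure \<Rightarrow> ('a \<Rightarrow> complex) \<Rightarrow> 'a set \<Rightarrow> complex"
  where "expectation_given M X A = (\<integral>\<omega>. X \<omega> \<partial>uniform_measure M A)"

end

theory Submission
  imports Defs
begin

text \<open>
  The size \<open>R\<^sub>s\<close> of the range of \<open>g\<^sub>s\<close> is a nonincreasing Markov chain started at \<open>R\<^sub>0 = n\<close>, and it
  stays at \<open>k\<close> with probability \<open>\<lambda>\<^sub>k\<close>. Write \<open>K = \<xi>\<close> and \<open>z = exp (\<i>t)\<close>, and give a step from \<open>k\<close>
  to \<open>j\<close> the weight 0 if it jumps over some level in \<open>{1..K}\<close>, otherwise \<open>z\<close> if \<open>k\<close> lies in
  \<open>{2..K}\<close> and 1 if not. The chain starts above \<open>K\<close> and ends at 1, so the product of the weights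
  along a whole trajectory is \<open>z\<close> to the power \<open>T\<^sub>1\<close> on the event that all levels are visited,
  and 0 off it. Let \<open>\<Phi>\<^sub>z\<close> solve the first-step equations with \<open>\<Phi>\<^sub>z(1) = 1\<close>. Then the weight up to
  time \<open>s\<close> times \<open>\<Phi>\<^sub>z(R\<^sub>s)\<close> is a bounded martingale, so the expected total weight is \<open>\<Phi>\<^sub>z(n)\<close>.
  Below \<open>K\<close> only unit steps down and stays have nonzero weight and \<open>\<Phi>\<^sub>z(K)\<close> is an explicit
  product; above \<open>K\<close> the weights do not involve \<open>z\<close>, so \<open>\<Phi>\<^sub>z(n)\<close> is this product times the
  probability of ever visiting \<open>K\<close>, which cancels in the quotient \<open>\<Phi>\<^sub>z(n) / \<Phi>\<^sub>1(n)\<close>.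
\<close>

declare One_nat_def [simp del]

section \<open>Image sizes of self-maps\<close>

lemma bij_betw_compose_PiE:
  assumes "bij_betw p X X'"
  shows "bij_betw (\<lambda>h. compose X h p) (X' \<rightarrow>\<^sub>E Y) (X \<rightarrow>\<^sub>E Y)"
proof (rule bij_betw_byWitness[where f' = "\<lambda>h. compose X' h (inv_into X p)"])
  have inv_into_p: "\<And>x. x \<in> X' \<Longrightarrow> inv_into X p x \<in> X \<and> p (inv_into X p x) = x"
    using assms bij_betwE[OF bij_betw_inv_into[OF assms]] by (simp add: bij_betw_inv_into_right)
  show "\<forall>h\<in>X' \<rightarrow>\<^sub>E Y. compose X' (compose X h p) (inv_into X p) = h"
    using inv_into_p by (auto simp: compose_def fun_eq_iff PiE_def extensional_def)
  show "\<forall>h\<in>X \<rightarrow>\<^sub>E Y. compose X (compose X' h (inv_into X p)) p = h"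
    using bij_betwE[OF assms] bij_betw_inv_into_left[OF assms]
    by (auto simp: compose_def fun_eq_iff PiE_def extensional_def)
  show "(\<lambda>h. compose X h p) ` (X' \<rightarrow>\<^sub>E Y) \<subseteq> X \<rightarrow>\<^sub>E Y"
    using bij_betwE[OF assms] by (auto simp: compose_def)
  show "(\<lambda>h. compose X' h (inv_into X p)) ` (X \<rightarrow>\<^sub>E Y) \<subseteq> X' \<rightarrow>\<^sub>E Y"
    using inv_into_p by (auto simp: compose_def)
qed

lemma obtain_permutation_image:
  assumes "finite X" "A \<subseteq> X" "B \<subseteq> X" "card A = card B"
  obtains p where "bij_betw p X X" "p ` A = B"
proof -
  have finite: "finite A" "finite B" using assms finite_subset by auto
  obtain q where q: "bij_betw q A B"
    using finite_same_card_bij[OF finite] assms by auto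
  have "card (X - A) = card (X - B)" using assms finite by (simp add: card_Diff_subset)
  then obtain r where r: "bij_betw r (X - A) (X - B)"
    using finite_same_card_bij[of "X - A" "X - B"] assms by auto
  define p where "p x = (if x \<in> A then q x else r x)" for x
  have p_inside: "bij_betw p A B"
    using q by (simp add: p_def cong: bij_betw_cong)
  moreover have "bij_betw p (X - A) (X - B)"
    using r by (subst bij_betw_cong[of _ _ r]) (auto simp: p_def)
  ultimately have "bij_betw p (A \<union> (X - A)) (B \<union> (X - B))" by (rule bij_betw_combine) auto
  then have "bij_betw p X X" using assms by (simp add: Un_absorb1)
  then show ?thesis using p_inside that by (simp add: bij_betw_def)
qed

lemma card_PiE_image_eq:
  assumes "finite X" "A \<subseteq> X" "B \<subseteq> X" "card A = card B"
  shows "card {h \<in> X \<rightarrow>\<^sub>E Y. P (h ` A)} = card {h \<in> X \<rightarrow>\<^sub>E Y. P (h ` B)}"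
proof -
  obtain p where p: "bij_betw p X X" "p ` B = A"
    using obtain_permutation_image[OF assms(1,3,2) assms(4)[symmetric]] .
  have "compose X h p ` B = h ` A" for h :: "'a \<Rightarrow> 'b"
    using assms(3) p(2) by (force simp: compose_def)
  then show ?thesis
    by (intro bij_betw_same_card[OF bij_betw_Collect[OF bij_betw_compose_PiE[OF p(1)]]]) simp
qed

lemma finite_self_maps: "finite (self_maps n)"
  by (simp add: finite_PiE)

lemma card_self_maps: "card (self_maps n) = n ^ n"
  by (simp add: card_funcsetE)

definition image_size_prob :: "nat \<Rightarrow> nat \<Rightarrow> nat \<Rightarrow> real"
  where "image_size_prob n k j = card {h \<in> self_maps n. card (h ` {1..k}) = j} / n ^ n"

lemma card_self_maps_card_image:
  assumes "A \<subseteq> {1..n}"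
  shows "real (card {h \<in> self_maps n. card (h ` A) = j}) = n ^ n * image_size_prob n (card A) j"
proof -
  have "card A \<le> n" using card_mono[OF _ assms] by simp
  then have "card {h \<in> self_maps n. card (h ` A) = j} =
      card {h \<in> self_maps n. card (h ` {1..card A}) = j}"
    using assms by (intro card_PiE_image_eq) auto
  then show ?thesis by (cases "n = 0") (simp_all add: image_size_prob_def)
qed

lemma sum_self_maps_card_image:
  fixes F :: "nat \<Rightarrow> 'a::real_vector"
  assumes "A \<subseteq> {1..n}" "A \<noteq> {}"
  shows "(\<Sum>h\<in>self_maps n. F (card (h ` A))) =
    n ^ n *\<^sub>R (\<Sum>j = 1..card A. image_size_prob n (card A) j *\<^sub>R F j)"
proof -
  have "finite A" using assms(1) finite_subset by blast
  then have "(\<Sum>h\<in>self_maps n. F (card (h ` A))) =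
      (\<Sum>j = 1..card A. \<Sum>h\<in>{h \<in> self_maps n. card (h ` A) = j}. F (card (h ` A)))"
    using assms(2) finite_self_maps
    by (intro sum.group[symmetric]) (auto simp: card_image_le Suc_le_eq card_gt_0_iff One_nat_def)
  also have "\<dots> = (\<Sum>j = 1..card A. real (card {h \<in> self_maps n. card (h ` A) = j}) *\<^sub>R F j)"
    by (simp add: sum_constant_scaleR)
  also have "\<dots> = n ^ n *\<^sub>R (\<Sum>j = 1..card A. image_size_prob n (card A) j *\<^sub>R F j)"
    unfolding card_self_maps_card_image[OF assms(1)] by (simp add: scaleR_right.sum)
  finally show ?thesis .
qed

lemma image_size_prob_self:
  assumes "k \<le> n"
  shows "image_size_prob n k k = lam n k"
proof -
  have "{h \<in> self_maps n. card (h ` {1..k}) = k} = {h \<in> self_maps n. inj_on h {1..k}}"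
    using inj_on_iff_eq_card[of "{1..k}"] by auto
  then have "image_size_prob n k k = n ^ (n - k) * (\<Prod>j<k. real (n - j)) / n ^ n"
    using assms by (simp add: image_size_prob_def card_inj_on_subset_funcset atLeast0LessThan)
  also have "n ^ n = n ^ (n - k) * n ^ k"
    using assms by (simp flip: power_add)
  also have "n ^ (n - k) * (\<Prod>j<k. real (n - j)) / \<dots> = (\<Prod>j<k. real (n - j) / n)"
    using assms by (cases "n = 0") (simp_all add: prod_dividef)
  also have "\<dots> = (\<Prod>j<k. 1 - real j / n)"
    using assms by (intro prod.cong) (auto simp: of_nat_diff field_simps)
  also have "\<dots> = lam n k"
    unfolding lam_def by (intro prod.mono_neutral_right) (auto simp: not_less_eq_eq)
  finally show ?thesis .
qed

lemma lam_1: "lam n 1 = 1"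
  by (simp add: lam_def)

lemma lam_nonneg: "k \<le> n \<Longrightarrow> 0 \<le> lam n k"
  unfolding lam_def by (intro prod_nonneg) (auto simp: field_simps)

lemma lam_less_1:
  assumes "2 \<le> k" "k \<le> n"
  shows "lam n k < 1"
proof -
  have "lam n k = (1 - 1 / n) * (\<Prod>j = 2..<k. 1 - real j / real n)"
    unfolding lam_def using assms
    by (subst prod.atLeast_Suc_lessThan) (auto simp: numeral_2_eq_2)
  also have "\<dots> \<le> (1 - 1 / n) * 1"
    using assms by (intro mult_left_mono prod_le_1) (auto simp: field_simps)
  also have "\<dots> < 1" using assms by simp
  finally show ?thesis .
qed

section \<open>Descending paths\<close>

definition skips :: "nat \<Rightarrow> nat \<Rightarrow> nat \<Rightarrow> bool"
  where "skips K k j \<longleftrightarrow> (\<exists>m\<in>{1..K}. j < m \<and> m < k)"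

definition step_weight :: "nat \<Rightarrow> complex \<Rightarrow> nat \<Rightarrow> nat \<Rightarrow> complex"
  where "step_weight K z k j = (if skips K k j then 0 else if k \<in> {2..K} then z else 1)"

definition path_weight :: "nat \<Rightarrow> complex \<Rightarrow> (nat \<Rightarrow> nat) \<Rightarrow> nat \<Rightarrow> complex"
  where "path_weight K z r t = (\<Prod>s<t. step_weight K z (r s) (r (Suc s)))"

lemma skips_iff: "skips K k j \<longleftrightarrow> j < K \<and> Suc j < k"
  unfolding skips_def by (auto intro!: bexI[of _ "Suc j"])

lemma norm_path_weight_le_1:
  assumes "norm z \<le> 1"
  shows "norm (path_weight K z r t) \<le> 1"
  unfolding path_weight_def prod_norm[symmetric]
  using assms by (intro prod_le_1) (auto simp: step_weight_def)

lemma path_weight_restrict: "path_weight K z (restrict r {..t}) t = path_weight K z r t"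
  by (simp add: path_weight_def)

lemma visits_all_iff_no_skip:
  assumes "antimono r" "r N = 1" "K \<le> r 0"
  shows "{1..K} \<subseteq> range r \<longleftrightarrow> (\<forall>s<N. \<not> skips K (r s) (r (Suc s)))"
proof
  assume visits_all: "{1..K} \<subseteq> range r"
  show "\<forall>s<N. \<not> skips K (r s) (r (Suc s))"
  proof (intro allI impI notI)
    fix s assume "skips K (r s) (r (Suc s))"
    then obtain m where skipped: "m \<in> {1..K}" "r (Suc s) < m" "m < r s" by (auto simp: skips_def)
    then obtain q where "r q = m" using visits_all by blast
    then show False
      using skipped antimonoD[OF assms(1), of q s] antimonoD[OF assms(1), of "Suc s" q]
      by (cases "q \<le> s") auto
  qed
next
  assume no_skip: "\<forall>s<N. \<not> skips K (r s) (r (Suc s))"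
  show "{1..K} \<subseteq> range r"
  proof
    fix m assume m_level: "m \<in> {1..K}"
    define q where "q = (LEAST s. r s \<le> m)"
    have "r N \<le> m" using assms m_level by simp
    then have first_below: "r q \<le> m" "q \<le> N" unfolding q_def by (rule LeastI, rule Least_le)
    show "m \<in> range r"
    proof (cases q)
      case 0
      then show ?thesis using first_below m_level assms(3) by (intro range_eqI[of _ _ 0]) auto
    next
      case (Suc s)
      then have "r s > m" using not_less_Least[of s "\<lambda>s. r s \<le> m"] by (auto simp: q_def)
      moreover have "\<not> skips K (r s) (r q)" using no_skip first_below Suc by auto
      ultimately have "r q = m" using first_below m_level by (auto simp: skips_iff)
      then show ?thesis by blast
    qed
  qed
qed

lemma path_weight_eq:
  assumes "antimono r" "r N = 1" "K \<le> r 0"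
  shows "path_weight K z r N = of_bool ({1..K} \<subseteq> range r) * z ^ card (r -` {2..K})"
proof (cases "{1..K} \<subseteq> range r")
  case True
  have "s < N" if "r s \<in> {2..K}" for s
    using that assms(2) antimonoD[OF assms(1), of N s] by (cases "s < N") auto
  then have visit_times: "r -` {2..K} = {s \<in> {..<N}. r s \<in> {2..K}}" by auto
  have "path_weight K z r N = (\<Prod>s<N. if r s \<in> {2..K} then z else 1)"
    using True unfolding visits_all_iff_no_skip[OF assms] path_weight_def
    by (intro prod.cong) (auto simp: step_weight_def)
  also have "\<dots> = z ^ card (r -` {2..K})"
    unfolding visit_times by (simp flip: prod.inter_filter)
  finally show ?thesis using True by simp
next
  case False
  then obtain s where "s < N" "skips K (r s) (r (Suc s))"
    unfolding visits_all_iff_no_skip[OF assms] by blast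
  then have "path_weight K z r N = 0"
    unfolding path_weight_def by (intro prod_zero) (auto simp: step_weight_def)
  then show ?thesis using False by simp
qed

text \<open>
  The first-step equation at \<open>k > K\<close>, solved for its value at \<open>k\<close>: the denominator accounts for the
  steps that stay at \<open>k\<close>.
\<close>

fun hit_prob :: "(nat \<Rightarrow> nat \<Rightarrow> real) \<Rightarrow> nat \<Rightarrow> nat \<Rightarrow> real" where
  "hit_prob p K k =
    (if k \<le> K then of_bool (k = K) else (\<Sum>j = K..<k. p k j * hit_prob p K j) / (1 - p k k))"

declare hit_prob.simps [simp del]

definition descent_gf :: "(nat \<Rightarrow> nat \<Rightarrow> real) \<Rightarrow> complex \<Rightarrow> nat \<Rightarrow> complex"
  where "descent_gf p z k = (\<Prod>m = 2..k. p m (m - 1) * z / (1 - p m m * z))"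

definition path_gf :: "(nat \<Rightarrow> nat \<Rightarrow> real) \<Rightarrow> nat \<Rightarrow> complex \<Rightarrow> nat \<Rightarrow> complex"
  where "path_gf p K z k =
    (if k \<le> K then descent_gf p z k else hit_prob p K k * descent_gf p z K)"

lemma of_real_mult_neq_1:
  fixes z :: "'a::real_normed_div_algebra"
  assumes "0 \<le> a" "a < 1" "norm z \<le> 1"
  shows "of_real a * z \<noteq> 1"
proof
  assume "of_real a * z = 1"
  then have "a * norm z = 1" using assms(1) by (metis norm_mult norm_of_real abs_of_nonneg norm_one)
  moreover have "a * norm z \<le> a * 1" using assms by (intro mult_left_mono) auto
  ultimately show False using assms(2) by simp
qed

lemma descent_gf_Suc:
  assumes "1 \<le> k"
  shows "descent_gf p z (Suc k) =
    descent_gf p z k * (p (Suc k) k * z / (1 - p (Suc k) (Suc k) * z))"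
  using assms by (simp add: descent_gf_def prod.nat_ivl_Suc')

lemma path_gf_harmonic_le:
  assumes "p 1 1 = 1" "1 \<le> k" "k \<le> K" "norm z \<le> 1"
    and stay_prob: "2 \<le> k \<Longrightarrow> 0 \<le> p k k \<and> p k k < 1"
  shows "(\<Sum>j = 1..k. p k j * step_weight K z k j * path_gf p K z j) = path_gf p K z k"
proof (cases "k = 1")
  case True
  then show ?thesis
    using assms by (simp add: step_weight_def skips_iff path_gf_def descent_gf_def)
next
  case False
  then obtain i where k_Suc: "k = Suc i" "1 \<le> i" using assms(2) by (cases k) auto
  have "(\<Sum>j = 1..k. p k j * step_weight K z k j * path_gf p K z j) =
      (\<Sum>j\<in>{i, k}. p k j * step_weight K z k j * path_gf p K z j)"
    using k_Suc assms(3) by (intro sum.mono_neutral_right) (auto simp: step_weight_def skips_iff)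
  also have "\<dots> = p k i * z * descent_gf p z i + p k k * z * descent_gf p z k"
    using k_Suc assms(3) by (simp add: step_weight_def skips_iff path_gf_def)
  also have "\<dots> = descent_gf p z k"
    using of_real_mult_neq_1[of "p k k" z] stay_prob k_Suc assms(4)
    by (simp add: descent_gf_Suc field_simps)
  finally show ?thesis using assms(3) by (simp add: path_gf_def)
qed

lemma path_gf_harmonic_gt:
  assumes "1 \<le> K" "K < k" "p k k < 1"
  shows "(\<Sum>j = 1..k. p k j * step_weight K z k j * path_gf p K z j) = path_gf p K z k"
proof -
  have "(\<Sum>j = 1..k. p k j * step_weight K z k j * path_gf p K z j) =
      (\<Sum>j = K..k. p k j * step_weight K z k j * path_gf p K z j)"
    using assms by (intro sum.mono_neutral_right) (auto simp: step_weight_def skips_iff)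
  also have "\<dots> = (\<Sum>j = K..k. p k j * hit_prob p K j) * descent_gf p z K"
    unfolding sum_distrib_right of_real_sum using assms
    by (intro sum.cong) (auto simp: step_weight_def skips_iff path_gf_def hit_prob.simps[of p K K])
  also have "(\<Sum>j = K..k. p k j * hit_prob p K j) =
      p k k * hit_prob p K k + (\<Sum>j = K..<k. p k j * hit_prob p K j)"
    using assms(2) by (simp add: sum.last_plus)
  also have "(\<Sum>j = K..<k. p k j * hit_prob p K j) = hit_prob p K k * (1 - p k k)"
    using assms by (subst (2) hit_prob.simps) simp
  finally show ?thesis using assms(2) by (simp add: path_gf_def algebra_simps)
qed

lemma path_gf_harmonic:
  assumes "p 1 1 = 1" "1 \<le> K" "1 \<le> k" "norm z \<le> 1"
    and "2 \<le> k \<Longrightarrow> 0 \<le> p k k \<and> p k k < 1"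
  shows "(\<Sum>j = 1..k. p k j * step_weight K z k j * path_gf p K z j) = path_gf p K z k"
proof (cases "k \<le> K")
  case True
  then show ?thesis using assms by (intro path_gf_harmonic_le)
next
  case False
  then show ?thesis using assms by (intro path_gf_harmonic_gt) auto
qed

lemma path_gf_divide:
  assumes "K < k" "path_gf p K 1 k \<noteq> 0"
  shows "path_gf p K z k / path_gf p K 1 k =
    z ^ (K - 1) * (\<Prod>m = 2..K. (1 - complex_of_real (p m m)) / (1 - p m m * z))"
proof -
  have path_gf_eq: "path_gf p K w k = hit_prob p K k * descent_gf p w K" for w
    using assms(1) by (simp add: path_gf_def)
  have hit_prob_nonzero: "hit_prob p K k \<noteq> 0" and "descent_gf p 1 K \<noteq> 0"
    using assms(2) by (auto simp: path_gf_eq)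
  then have step_down_nonzero: "p m (m - 1) \<noteq> 0" if "m \<in> {2..K}" for m
    using that by (auto simp: descent_gf_def prod_zero_iff)
  have "path_gf p K z k / path_gf p K 1 k = descent_gf p z K / descent_gf p 1 K"
    using hit_prob_nonzero by (simp add: path_gf_eq)
  also have "\<dots> = (\<Prod>m = 2..K. z * ((1 - complex_of_real (p m m)) / (1 - p m m * z)))"
    unfolding descent_gf_def prod_dividef[symmetric]
    using step_down_nonzero by (intro prod.cong) auto
  also have "\<dots> = z ^ (K - 1) * (\<Prod>m = 2..K. (1 - complex_of_real (p m m)) / (1 - p m m * z))"
    by (subst prod.distrib) simp
  finally show ?thesis .
qed

section \<open>Independence and conditioning\<close>

lemma (in prob_space) integral_indep_var:
  fixes G :: "'b \<Rightarrow> 'b \<Rightarrow> 'c::{banach, second_countable_topology}"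
  assumes indep: "indep_var S X T Y"
    and [measurable]: "case_prod G \<in> borel_measurable (S \<Otimes>\<^sub>M T)"
    and integrable: "integrable M (\<lambda>\<omega>. G (X \<omega>) (Y \<omega>))"
  shows "(\<integral>\<omega>. G (X \<omega>) (Y \<omega>) \<partial>M) = (\<integral>\<omega>. \<integral>\<omega>'. G (X \<omega>) (Y \<omega>') \<partial>M \<partial>M)"
proof -
  have [measurable]: "random_variable S X" "random_variable T Y"
    and joint: "distr M (S \<Otimes>\<^sub>M T) (\<lambda>\<omega>. (X \<omega>, Y \<omega>)) = distr M S X \<Otimes>\<^sub>M distr M T Y"
    using indep by (auto simp: indep_var_distribution_eq)
  interpret X: prob_space "distr M S X" by (rule prob_space_distr) simp
  interpret Y: prob_space "distr M T Y" by (rule prob_space_distr) simp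
  interpret pair_sigma_finite "distr M S X" "distr M T Y" ..
  have "(\<integral>\<omega>. G (X \<omega>) (Y \<omega>) \<partial>M) = integral\<^sup>L (distr M S X \<Otimes>\<^sub>M distr M T Y) (case_prod G)"
    by (simp add: integral_distr flip: joint)
  also have "\<dots> = (\<integral>x. \<integral>y. G x y \<partial>distr M T Y \<partial>distr M S X)"
    using integrable by (intro integral_fst[symmetric]) (simp add: integrable_distr_eq flip: joint)
  also have "\<dots> = (\<integral>\<omega>. \<integral>y. G (X \<omega>) y \<partial>distr M T Y \<partial>M)"
    by (rule integral_distr) measurable
  also have "\<dots> = (\<integral>\<omega>. \<integral>\<omega>'. G (X \<omega>) (Y \<omega>') \<partial>M \<partial>M)"
  proof (rule Bochner_Integration.integral_cong[OF refl])
    fix \<omega> assume "\<omega> \<in> space M"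
    then have [measurable]: "X \<omega> \<in> space S" by (rule measurable_space[rotated]) simp
    show "(\<integral>y. G (X \<omega>) y \<partial>distr M T Y) = (\<integral>\<omega>'. G (X \<omega>) (Y \<omega>') \<partial>M)"
      by (rule integral_distr) measurable
  qed
  finally show ?thesis .
qed

lemma (in finite_measure) integrable_finite_range:
  fixes G :: "'b \<Rightarrow> 'c::{banach, second_countable_topology}"
  assumes "finite S" "Z \<in> M \<rightarrow>\<^sub>M count_space S"
  shows "integrable M (\<lambda>\<omega>. G (Z \<omega>))"
proof (rule integrable_const_bound)
  show "(\<lambda>\<omega>. G (Z \<omega>)) \<in> borel_measurable M"
    using assms(2) by (rule measurable_compose) simp
  show "AE \<omega> in M. norm (G (Z \<omega>)) \<le> (\<Sum>s\<in>S. norm (G s))"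
    using assms measurable_space[OF assms(2)] by (intro AE_I2 member_le_sum) auto
qed

lemma (in prob_space) prob_indep_vars_miss_le:
  assumes indep: "indep_vars N X I"
    and B_sets: "\<And>i. i \<in> I \<Longrightarrow> B i \<in> sets (N i)"
    and hit: "\<And>i. i \<in> I \<Longrightarrow> q \<le> prob (X i -` B i \<inter> space M)"
    and J: "J \<subseteq> I" "finite J" "J \<noteq> {}"
  shows "prob (\<Inter>i\<in>J. X i -` (space (N i) - B i) \<inter> space M) \<le> (1 - q) ^ card J"
proof -
  have miss: "prob (X i -` (space (N i) - B i) \<inter> space M) \<le> 1 - q" if "i \<in> J" for i
  proof -
    have "i \<in> I" using that J(1) by blast
    then have X_i: "X i \<in> M \<rightarrow>\<^sub>M N i" using indep by (auto simp: indep_vars_def)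
    have "X i -` (space (N i) - B i) \<inter> space M = space M - (X i -` B i \<inter> space M)"
      using measurable_space[OF X_i] by auto
    then show ?thesis
      using \<open>i \<in> I\<close> hit[of i] measurable_sets[OF X_i B_sets] by (simp add: prob_compl)
  qed
  have "prob (\<Inter>i\<in>J. X i -` (space (N i) - B i) \<inter> space M) =
      (\<Prod>i\<in>J. prob (X i -` (space (N i) - B i) \<inter> space M))"
    using B_sets J by (intro indep_varsD[OF indep]) auto
  also have "\<dots> \<le> (\<Prod>i\<in>J. 1 - q)"
    using miss by (intro prod_mono) auto
  finally show ?thesis by simp
qed

lemma (in prob_space) AE_indep_vars_hit:
  assumes indep: "indep_vars N X I" and "infinite I"
    and B_sets: "\<And>i. i \<in> I \<Longrightarrow> B i \<in> sets (N i)"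
    and "0 < q" and hit: "\<And>i. i \<in> I \<Longrightarrow> q \<le> prob (X i -` B i \<inter> space M)"
  shows "AE \<omega> in M. \<exists>i\<in>I. X i \<omega> \<in> B i"
proof -
  have X_i: "X i \<in> M \<rightarrow>\<^sub>M N i" if "i \<in> I" for i
    using indep that by (auto simp: indep_vars_def)
  obtain i where "i \<in> I" using infinite_imp_nonempty[OF \<open>infinite I\<close>] by blast
  then have "q \<le> 1" using hit prob_le_1 order_trans by blast
  have "\<exists>J\<subseteq>I. finite J \<and> card J = Suc k" for k
    using infinite_arbitrarily_large[OF \<open>infinite I\<close>] by blast
  then obtain J where J: "\<And>k. J k \<subseteq> I" "\<And>k. finite (J k)" "\<And>k. card (J k) = Suc k" by metis
  then have J_nonempty: "J k \<noteq> {}" for k by (metis card.empty nat.distinct(1))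
  define miss where "miss k = (\<Inter>i\<in>J k. X i -` (space (N i) - B i) \<inter> space M)" for k
  have miss_event: "miss k \<in> events" for k
    unfolding miss_def using J(1) B_sets
    by (intro sets.finite_INT[OF J(2) J_nonempty] measurable_sets[OF X_i]) auto
  have "prob (\<Inter>k. miss k) \<le> (1 - q) ^ Suc k" for k
  proof -
    have "prob (\<Inter>k. miss k) \<le> prob (miss k)"
      by (intro finite_measure_mono miss_event INT_lower) simp
    also have "\<dots> \<le> (1 - q) ^ card (J k)"
      unfolding miss_def by (intro prob_indep_vars_miss_le[OF indep] B_sets hit J J_nonempty)
    finally show ?thesis by (simp only: J(3))
  qed
  moreover have "(\<lambda>k. (1 - q) ^ Suc k) \<longlonglongrightarrow> 0"
    using \<open>0 < q\<close> \<open>q \<le> 1\<close> by (intro LIMSEQ_Suc LIMSEQ_realpow_zero) auto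
  ultimately have "prob (\<Inter>k. miss k) \<le> 0" by (meson LIMSEQ_le_const)
  moreover have "(\<Inter>k. miss k) \<in> events" using miss_event by blast
  ultimately have "AE \<omega> in M. \<omega> \<notin> (\<Inter>k. miss k)"
    by (subst prob_eq_0[symmetric]) (auto intro: antisym)
  then show ?thesis
    using AE_space
  proof eventually_elim
    case (elim \<omega>)
    then obtain k i where "i \<in> J k" "\<omega> \<notin> X i -` (space (N i) - B i) \<inter> space M"
      by (auto simp: miss_def)
    then show ?case using J(1)[of k] elim measurable_space[OF X_i] by auto
  qed
qed

lemma expectation_given_eq_divide:
  assumes "A \<in> sets M" "X \<in> borel_measurable M" "0 < measure M A"
  shows "expectation_given M X A = (\<integral>\<omega>. indicator A \<omega> * X \<omega> \<partial>M) / measure M A"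
proof -
  have "emeasure M A = ennreal (measure M A)"
    using assms(3) by (metis emeasure_eq_ennreal_measure measure_def enn2real_top less_irrefl)
  then have "uniform_measure M A = density M (\<lambda>\<omega>. ennreal (indicator A \<omega> / measure M A))"
    unfolding uniform_measure_def using assms
    by (intro arg_cong[where f = "density M"] ext)
      (auto simp: indicator_def divide_ennreal simp flip: ennreal_1)
  then have "expectation_given M X A = (\<integral>\<omega>. (indicator A \<omega> / measure M A) *\<^sub>R X \<omega> \<partial>M)"
    unfolding expectation_given_def using assms
    by (simp only:) (subst integral_density, auto)
  also have "\<dots> = (\<integral>\<omega>. (indicator A \<omega> * X \<omega>) / measure M A \<partial>M)"
    by (intro Bochner_Integration.integral_cong) (auto simp: indicator_def scaleR_conv_of_real)
  also have "\<dots> = (\<integral>\<omega>. indicator A \<omega> * X \<omega> \<partial>M) / measure M A"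
    by simp
  finally show ?thesis .
qed

section \<open>Compositions of random self-maps\<close>

definition range_size :: "nat \<Rightarrow> (nat \<Rightarrow> nat \<Rightarrow> nat) \<Rightarrow> nat \<Rightarrow> nat"
  where "range_size n \<phi> t = card (g n \<phi> t ` {1..n})"

lemma g_image_Suc: "g n \<phi> (Suc t) ` {1..n} = \<phi> (Suc t) ` g n \<phi> t ` {1..n}"
  by (cases t) (auto simp: compose_def image_image One_nat_def)

lemma g_restrict: "s \<le> t \<Longrightarrow> g n (restrict \<phi> {1..t}) s = g n \<phi> s"
  by (induction n \<phi> s rule: g.induct) auto

lemma g_image_subset:
  assumes "\<And>s. 1 \<le> s \<Longrightarrow> s \<le> t \<Longrightarrow> \<phi> s \<in> self_maps n"
  shows "g n \<phi> t ` {1..n} \<subseteq> {1..n}"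
  using assms
proof (induction t)
  case (Suc t)
  have "\<phi> (Suc t) \<in> self_maps n" using Suc.prems by simp
  moreover have "g n \<phi> t ` {1..n} \<subseteq> {1..n}" using Suc by simp
  ultimately show ?case unfolding g_image_Suc by (auto simp: PiE_iff image_subset_iff)
qed simp

lemma range_size_0: "range_size n \<phi> 0 = n"
  by (simp add: range_size_def)

lemma range_size_Suc: "range_size n \<phi> (Suc t) = card (\<phi> (Suc t) ` g n \<phi> t ` {1..n})"
  by (simp only: range_size_def g_image_Suc)

lemma range_size_restrict: "s \<le> t \<Longrightarrow> range_size n (restrict \<phi> {1..t}) s = range_size n \<phi> s"
  by (simp only: range_size_def g_restrict)

lemma antimono_range_size: "antimono (range_size n \<phi>)"
  unfolding decseq_Suc_iff range_size_Suc by (simp add: range_size_def card_image_le)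

lemma range_size_pos: "0 < n \<Longrightarrow> 0 < range_size n \<phi> t"
  by (auto simp: range_size_def card_gt_0_iff)

lemma range_size_le: "range_size n \<phi> t \<le> n"
  using antimonoD[OF antimono_range_size, of 0 t n \<phi>] by (simp add: range_size_0)

lemma tau_eq_emeasure_vimage:
  assumes "m < n"
  shows "\<tau> n \<phi> m = emeasure (count_space UNIV) (range_size n \<phi> -` {m})"
proof -
  have "1 \<le> t" if "range_size n \<phi> t = m" for t
    using that assms range_size_0[of n \<phi>] by (cases t) auto
  then have "{t. 1 \<le> t \<and> card (g n \<phi> t ` {1..n}) = m} = range_size n \<phi> -` {m}"
    unfolding range_size_def[symmetric] by auto
  then show ?thesis by (simp only: \<tau>_def)
qed

lemma tau_pos_iff:
  assumes "m < n"
  shows "0 < \<tau> n \<phi> m \<longleftrightarrow> m \<in> range (range_size n \<phi>)"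
  unfolding tau_eq_emeasure_vimage[OF assms]
  by (auto simp: zero_less_iff_neq_zero emeasure_count_space_eq_0)

text \<open>If a level in \<open>{2..K}\<close> is occupied forever, both sides are 0 by convention.\<close>

lemma sum_tau_eq_card:
  assumes "K < n"
  shows "enn2real (\<Sum>m = 2..K. \<tau> n \<phi> m) = card (range_size n \<phi> -` {2..K})"
proof -
  have "(\<Sum>m = 2..K. \<tau> n \<phi> m) =
      (\<Sum>m = 2..K. emeasure (count_space UNIV) (range_size n \<phi> -` {m}))"
    using assms by (intro sum.cong tau_eq_emeasure_vimage) auto
  also have "\<dots> = emeasure (count_space UNIV) (\<Union>m\<in>{2..K}. range_size n \<phi> -` {m})"
    by (intro sum_emeasure) (auto simp: disjoint_family_on_def)
  also have "(\<Union>m\<in>{2..K}. range_size n \<phi> -` {m}) = range_size n \<phi> -` {2..K}" by auto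
  finally show ?thesis by (simp add: Measure_Space.measure_count_space flip: measure_def)
qed

lemma xi_less:
  assumes "2 \<le> n" "1 \<le> \<xi> n"
  shows "nat (\<xi> n) < n"
proof -
  have "real_of_int (\<xi> n) \<le> ln (ln n)" unfolding \<xi>_def by (rule of_int_floor_le)
  also have "\<dots> \<le> ln n - 1" using assms by (intro ln_le_minus_one) auto
  also have "\<dots> \<le> real n - 1 - 1" using assms by (intro diff_right_mono ln_le_minus_one) auto
  finally show ?thesis using assms by linarith
qed

locale random_self_maps = prob_space M for M :: "'a measure" +
  fixes n :: nat and f :: "nat \<Rightarrow> 'a \<Rightarrow> nat \<Rightarrow> nat"
  assumes n_pos: "0 < n"
    and indep: "indep_vars (\<lambda>_. count_space (self_maps n)) f {1..}"
    and uniform: "\<And>s. 1 \<le> s \<Longrightarrow>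
      distr M (count_space (self_maps n)) (f s) = uniform_count_measure (self_maps n)"
begin

abbreviation sizes :: "'a \<Rightarrow> nat \<Rightarrow> nat"
  where "sizes \<omega> \<equiv> range_size n (\<lambda>s. f s \<omega>)"

abbreviation initial_maps :: "nat \<Rightarrow> 'a \<Rightarrow> nat \<Rightarrow> nat \<Rightarrow> nat"
  where "initial_maps t \<omega> \<equiv> (\<lambda>s\<in>{1..t}. f s \<omega>)"

lemma measurable_map: "1 \<le> s \<Longrightarrow> f s \<in> M \<rightarrow>\<^sub>M count_space (self_maps n)"
  using indep by (auto simp: indep_vars_def)

lemma map_in_self_maps: "1 \<le> s \<Longrightarrow> \<omega> \<in> space M \<Longrightarrow> f s \<omega> \<in> self_maps n"
  using measurable_space[OF measurable_map] by simp

lemma g_image_maps_subset: "\<omega> \<in> space M \<Longrightarrow> g n (\<lambda>s. f s \<omega>) t ` {1..n} \<subseteq> {1..n}"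
  by (intro g_image_subset map_in_self_maps)

lemma integral_map:
  fixes F :: "(nat \<Rightarrow> nat) \<Rightarrow> 'b::{banach, second_countable_topology}"
  assumes "1 \<le> s"
  shows "(\<integral>\<omega>. F (f s \<omega>) \<partial>M) = (\<Sum>h\<in>self_maps n. F h) /\<^sub>R n ^ n"
proof -
  have "(\<integral>\<omega>. F (f s \<omega>) \<partial>M) = integral\<^sup>L (uniform_count_measure (self_maps n)) F"
    unfolding uniform[OF assms, symmetric]
    using measurable_map[OF assms] by (intro integral_distr[symmetric]) auto
  also have "\<dots> = (\<Sum>h\<in>self_maps n. F h) /\<^sub>R n ^ n"
    by (simp add: uniform_count_measure_def lebesgue_integral_point_measure_finite
        finite_self_maps card_self_maps scaleR_right.sum inverse_eq_divide)
  finally show ?thesis .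
qed

lemma integral_card_image:
  fixes F :: "nat \<Rightarrow> 'b::{banach, second_countable_topology}"
  assumes "1 \<le> s" "A \<subseteq> {1..n}" "A \<noteq> {}"
  shows "(\<integral>\<omega>. F (card (f s \<omega> ` A)) \<partial>M) =
    (\<Sum>j = 1..card A. image_size_prob n (card A) j *\<^sub>R F j)"
  using n_pos integral_map[OF assms(1), of "\<lambda>h. F (card (h ` A))"]
  by (simp add: sum_self_maps_card_image[OF assms(2,3)])

lemma indep_var_initial_maps:
  "indep_var (count_space ({1..t} \<rightarrow>\<^sub>E self_maps n)) (initial_maps t)
    (count_space ({Suc t} \<rightarrow>\<^sub>E self_maps n)) (\<lambda>\<omega>. \<lambda>s\<in>{Suc t}. f s \<omega>)"
proof -
  have "PiM A (\<lambda>_. count_space (self_maps n)) = count_space (A \<rightarrow>\<^sub>E self_maps n)"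
    if "finite A" for A :: "nat set"
    using that by (intro count_space_PiM_finite countable_finite finite_self_maps)
  then show ?thesis
    using indep_var_restrict[OF indep, of "{1..t}" "{Suc t}"] by simp
qed

lemma measurable_initial_maps:
  "initial_maps t \<in> M \<rightarrow>\<^sub>M count_space ({1..t} \<rightarrow>\<^sub>E self_maps n)"
  using indep_var_initial_maps by (rule indep_var_rv1)

lemma measurable_sizes [measurable]: "(\<lambda>\<omega>. sizes \<omega> t) \<in> M \<rightarrow>\<^sub>M count_space UNIV"
proof -
  have "(\<lambda>\<omega>. range_size n (initial_maps t \<omega>) t) \<in> M \<rightarrow>\<^sub>M count_space UNIV"
    using measurable_initial_maps by (rule measurable_compose) simp
  then show ?thesis by (simp add: range_size_restrict)
qed

lemma borel_measurable_sizes [measurable]: "(\<lambda>\<omega>. sizes \<omega> t) \<in> borel_measurable M"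
  using measurable_sizes by (rule measurable_compose) simp

lemma integral_initial_maps_Suc:
  fixes G :: "(nat \<Rightarrow> nat \<Rightarrow> nat) \<Rightarrow> (nat \<Rightarrow> nat) \<Rightarrow> 'b::{banach, second_countable_topology}"
  shows "(\<integral>\<omega>. G (initial_maps t \<omega>) (f (Suc t) \<omega>) \<partial>M) =
    (\<integral>\<omega>. \<integral>\<omega>'. G (initial_maps t \<omega>) (f (Suc t) \<omega>') \<partial>M \<partial>M)"
proof -
  let ?S = "{1..t} \<rightarrow>\<^sub>E self_maps n" and ?T = "{Suc t} \<rightarrow>\<^sub>E self_maps n"
  let ?next = "\<lambda>\<omega>. \<lambda>s\<in>{Suc t}. f s \<omega>" and ?G = "\<lambda>a b. G a (b (Suc t))"
  have finite: "finite ?S" "finite ?T" by (intro finite_PiE finite_self_maps; simp)+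
  then have pair_count_space: "count_space ?S \<Otimes>\<^sub>M count_space ?T = count_space (?S \<times> ?T)"
    by (intro pair_measure_countable countable_finite)
  have "(\<lambda>\<omega>. (initial_maps t \<omega>, ?next \<omega>)) \<in> M \<rightarrow>\<^sub>M count_space (?S \<times> ?T)"
    unfolding pair_count_space[symmetric]
    by (intro measurable_Pair indep_var_rv1[OF indep_var_initial_maps]
        indep_var_rv2[OF indep_var_initial_maps])
  then have "integrable M (\<lambda>\<omega>. case_prod ?G (initial_maps t \<omega>, ?next \<omega>))"
    using finite by (intro integrable_finite_range[of "?S \<times> ?T"]) simp_all
  then have "(\<integral>\<omega>. ?G (initial_maps t \<omega>) (?next \<omega>) \<partial>M) =
      (\<integral>\<omega>. \<integral>\<omega>'. ?G (initial_maps t \<omega>) (?next \<omega>') \<partial>M \<partial>M)"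
    by (intro integral_indep_var[OF indep_var_initial_maps, of ?G])
      (simp_all only: pair_count_space borel_measurable_count_space prod.case)
  then show ?thesis by simp
qed

lemma markov_sizes:
  fixes F :: "(nat \<Rightarrow> nat) \<Rightarrow> nat \<Rightarrow> 'b::{banach, second_countable_topology}"
  shows "(\<integral>\<omega>. F (restrict (sizes \<omega>) {..t}) (sizes \<omega> (Suc t)) \<partial>M) =
    (\<integral>\<omega>. (\<Sum>j = 1..sizes \<omega> t.
      image_size_prob n (sizes \<omega> t) j *\<^sub>R F (restrict (sizes \<omega>) {..t}) j) \<partial>M)"
proof -
  define G where
    "G a h = F (restrict (range_size n a) {..t}) (card (h ` g n a t ` {1..n}))"
    for a and h :: "nat \<Rightarrow> nat"
  have G_initial_maps: "G (initial_maps t \<omega>) h =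
      F (restrict (sizes \<omega>) {..t}) (card (h ` g n (\<lambda>s. f s \<omega>) t ` {1..n}))" for \<omega> h
  proof -
    have "restrict (range_size n (initial_maps t \<omega>)) {..t} = restrict (sizes \<omega>) {..t}"
      by (intro restrict_ext range_size_restrict) simp
    then show ?thesis by (simp only: G_def g_restrict[OF order.refl])
  qed
  have "(\<integral>\<omega>. F (restrict (sizes \<omega>) {..t}) (sizes \<omega> (Suc t)) \<partial>M) =
      (\<integral>\<omega>. G (initial_maps t \<omega>) (f (Suc t) \<omega>) \<partial>M)"
    by (simp only: G_initial_maps range_size_Suc)
  also have "\<dots> = (\<integral>\<omega>. \<integral>\<omega>'. G (initial_maps t \<omega>) (f (Suc t) \<omega>') \<partial>M \<partial>M)"
    by (rule integral_initial_maps_Suc)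
  also have "\<dots> = (\<integral>\<omega>. (\<Sum>j = 1..sizes \<omega> t.
      image_size_prob n (sizes \<omega> t) j *\<^sub>R F (restrict (sizes \<omega>) {..t}) j) \<partial>M)"
    unfolding G_initial_maps using n_pos g_image_maps_subset
    by (intro Bochner_Integration.integral_cong refl)
      (subst integral_card_image, auto simp: range_size_def)
  finally show ?thesis .
qed

lemma AE_sizes_eq_1: "AE \<omega> in M. \<exists>t. sizes \<omega> t = 1"
proof -
  define const_1 :: "nat \<Rightarrow> nat" where "const_1 = (\<lambda>x\<in>{1..n}. 1)"
  have const_1: "const_1 \<in> self_maps n" using n_pos by (auto simp: const_1_def)
  have "prob (f s -` {const_1} \<inter> space M) = 1 / n ^ n" if "1 \<le> s" for s
  proof -
    have "prob (f s -` {const_1} \<inter> space M) =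
        measure (uniform_count_measure (self_maps n)) {const_1}"
      unfolding uniform[OF that, symmetric] using const_1 measurable_map[OF that]
      by (simp add: measure_distr)
    then show ?thesis
      using const_1 by (simp add: measure_uniform_count_measure finite_self_maps card_self_maps)
  qed
  then have "AE \<omega> in M. \<exists>s\<in>{1..}. f s \<omega> \<in> {const_1}"
    using const_1 n_pos
    by (intro AE_indep_vars_hit[OF indep, where B = "\<lambda>_. {const_1}" and q = "1 / n ^ n"])
      (auto simp: infinite_Ici)
  then show ?thesis
    using AE_space
  proof eventually_elim
    case (elim \<omega>)
    then obtain t where f_Suc: "f (Suc t) \<omega> = const_1"
      by (auto simp: Suc_le_eq gr0_conv_Suc One_nat_def)
    have "const_1 ` g n (\<lambda>s. f s \<omega>) t ` {1..n} = (\<lambda>_. 1) ` g n (\<lambda>s. f s \<omega>) t ` {1..n}"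
      using g_image_maps_subset[OF elim(2), of t]
      by (intro image_cong refl) (auto simp: const_1_def)
    also have "\<dots> = {1}" using n_pos by (simp add: image_constant_conv)
    finally have "card (const_1 ` g n (\<lambda>s. f s \<omega>) t ` {1..n}) = 1" by simp
    then have "sizes \<omega> (Suc t) = 1" by (simp add: range_size_Suc f_Suc)
    then show ?case ..
  qed
qed

definition potential :: "nat \<Rightarrow> complex \<Rightarrow> nat \<Rightarrow> 'a \<Rightarrow> complex"
  where "potential K z t \<omega> =
    path_weight K z (sizes \<omega>) t * path_gf (image_size_prob n) K z (sizes \<omega> t)"

lemma measurable_potential [measurable]: "potential K z t \<in> borel_measurable M"
  unfolding potential_def path_weight_def by measurable

lemma norm_potential_le:
  assumes "norm z \<le> 1"
  shows "norm (potential K z t \<omega>) \<le> (\<Sum>k\<le>n. norm (path_gf (image_size_prob n) K z k))"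
proof -
  let ?\<Phi> = "path_gf (image_size_prob n) K z"
  have "norm (potential K z t \<omega>) \<le> 1 * norm (?\<Phi> (sizes \<omega> t))"
    unfolding potential_def norm_mult
    by (intro mult_right_mono norm_path_weight_le_1 assms) simp
  also have "\<dots> \<le> (\<Sum>k\<le>n. norm (?\<Phi> k))"
    unfolding mult_1 by (intro member_le_sum) (auto simp: range_size_le)
  finally show ?thesis .
qed

lemma potential_harmonic:
  assumes "1 \<le> K" "norm z \<le> 1"
  shows "(\<Sum>j = 1..sizes \<omega> t. image_size_prob n (sizes \<omega> t) j *\<^sub>R
      (path_weight K z (sizes \<omega>) t * step_weight K z (sizes \<omega> t) j *
        path_gf (image_size_prob n) K z j)) = potential K z t \<omega>"
proof -
  let ?p = "image_size_prob n" and ?k = "sizes \<omega> t"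
  have "1 \<le> ?k" "?k \<le> n"
    using range_size_pos[OF n_pos, of "\<lambda>s. f s \<omega>" t] range_size_le by (simp_all add: Suc_le_eq)
  then have "(\<Sum>j = 1..?k. ?p ?k j * step_weight K z ?k j * path_gf ?p K z j) = path_gf ?p K z ?k"
    using assms n_pos
    by (intro path_gf_harmonic) (auto simp: image_size_prob_self lam_1 lam_nonneg lam_less_1)
  moreover have "(\<Sum>j = 1..?k. ?p ?k j *\<^sub>R
      (path_weight K z (sizes \<omega>) t * step_weight K z ?k j * path_gf ?p K z j)) =
    path_weight K z (sizes \<omega>) t * (\<Sum>j = 1..?k. ?p ?k j * step_weight K z ?k j * path_gf ?p K z j)"
    by (simp add: scaleR_conv_of_real sum_distrib_left mult_ac)
  ultimately show ?thesis by (simp add: potential_def)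
qed

lemma integral_potential:
  assumes "1 \<le> K" "norm z \<le> 1"
  shows "(\<integral>\<omega>. potential K z t \<omega> \<partial>M) = path_gf (image_size_prob n) K z n"
proof (induction t)
  case 0
  then show ?case by (simp add: potential_def path_weight_def range_size_0 prob_space)
next
  case (Suc t)
  let ?F = "\<lambda>r j. path_weight K z r t * step_weight K z (r t) j * path_gf (image_size_prob n) K z j"
  have F_restrict: "?F (restrict (sizes \<omega>) {..t}) j = ?F (sizes \<omega>) j" for \<omega> j
    by (simp add: path_weight_restrict)
  have "potential K z (Suc t) \<omega> = ?F (restrict (sizes \<omega>) {..t}) (sizes \<omega> (Suc t))" for \<omega>
    unfolding F_restrict by (simp add: potential_def path_weight_def)
  then have "(\<integral>\<omega>. potential K z (Suc t) \<omega> \<partial>M) = (\<integral>\<omega>. potential K z t \<omega> \<partial>M)"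
    using markov_sizes[of ?F t] by (simp only: F_restrict potential_harmonic[OF assms])
  then show ?case using Suc.IH by simp
qed

lemma AE_potential_eventually_eq:
  assumes "1 \<le> K" "K \<le> n"
  shows "AE \<omega> in M. \<forall>\<^sub>F t in sequentially. potential K z t \<omega> =
    of_bool ({1..K} \<subseteq> range (sizes \<omega>)) * z ^ card (sizes \<omega> -` {2..K})"
  using AE_sizes_eq_1
proof eventually_elim
  case (elim \<omega>)
  then obtain N where absorbed: "sizes \<omega> N = 1" by blast
  have "potential K z t \<omega> = of_bool ({1..K} \<subseteq> range (sizes \<omega>)) * z ^ card (sizes \<omega> -` {2..K})"
    if "N \<le> t" for t
  proof -
    have size_1: "sizes \<omega> t = 1"
      using antimonoD[OF antimono_range_size that, of n "\<lambda>s. f s \<omega>"] absorbed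
        range_size_pos[OF n_pos, of "\<lambda>s. f s \<omega>" t] by simp
    then have "potential K z t \<omega> = path_weight K z (sizes \<omega>) t"
      using assms(1) by (simp add: potential_def path_gf_def descent_gf_def)
    then show ?thesis
      using path_weight_eq[OF antimono_range_size size_1] assms(2) by (simp add: range_size_0)
  qed
  then show ?case unfolding eventually_sequentially by blast
qed

lemma integral_visits_all:
  assumes "1 \<le> K" "K \<le> n" "norm z \<le> 1"
  shows "(\<integral>\<omega>. of_bool ({1..K} \<subseteq> range (sizes \<omega>)) * z ^ card (sizes \<omega> -` {2..K}) \<partial>M) =
    path_gf (image_size_prob n) K z n"
proof -
  let ?X = "\<lambda>\<omega>. of_bool ({1..K} \<subseteq> range (sizes \<omega>)) * z ^ card (sizes \<omega> -` {2..K})"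
  have "(\<lambda>t. \<integral>\<omega>. potential K z t \<omega> \<partial>M) \<longlonglongrightarrow> (\<integral>\<omega>. ?X \<omega> \<partial>M)"
  proof (rule integral_dominated_convergence)
    show "?X \<in> borel_measurable M"
      unfolding subset_eq image_iff vimage_def by measurable
    show "AE \<omega> in M. (\<lambda>t. potential K z t \<omega>) \<longlonglongrightarrow> ?X \<omega>"
      using AE_potential_eventually_eq[OF assms(1,2)]
      by eventually_elim (rule tendsto_eventually)
    show "AE \<omega> in M. norm (potential K z t \<omega>) \<le>
        (\<Sum>k\<le>n. norm (path_gf (image_size_prob n) K z k))" for t
      by (intro AE_I2 norm_potential_le assms(3))
  qed simp_all
  then show ?thesis
    unfolding integral_potential[OF assms(1,3)] by (simp add: LIMSEQ_const_iff)
qed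

lemma measurable_T1:
  assumes "nat (\<xi> n) < n"
  shows "(\<lambda>\<omega>. enn2real (T\<^sub>1 n (\<lambda>s. f s \<omega>))) \<in> borel_measurable M"
  unfolding T\<^sub>1_def sum_tau_eq_card[OF assms] vimage_def by measurable

lemma all_visited_eq:
  assumes "nat (\<xi> n) < n"
  shows "all_visited M n f = {\<omega> \<in> space M. {1..nat (\<xi> n)} \<subseteq> range (sizes \<omega>)}"
  using assms by (auto simp: all_visited_def tau_pos_iff subset_iff)

lemma all_visited_event:
  assumes "nat (\<xi> n) < n"
  shows "all_visited M n f \<in> events"
  unfolding all_visited_eq[OF assms] subset_eq image_iff by measurable

lemma integral_all_visited:
  assumes "1 \<le> \<xi> n" "nat (\<xi> n) < n"
  shows "(\<integral>\<omega>. indicator (all_visited M n f) \<omega> *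
      iexp (u * enn2real (T\<^sub>1 n (\<lambda>s. f s \<omega>))) \<partial>M) =
    path_gf (image_size_prob n) (nat (\<xi> n)) (iexp u) n"
proof -
  let ?K = "nat (\<xi> n)"
  have "iexp (u * enn2real (T\<^sub>1 n (\<lambda>s. f s \<omega>))) = iexp u ^ card (sizes \<omega> -` {2..?K})" for \<omega>
    by (simp add: T\<^sub>1_def sum_tau_eq_card[OF assms(2)] mult_ac flip: exp_of_nat_mult)
  then have "indicator (all_visited M n f) \<omega> * iexp (u * enn2real (T\<^sub>1 n (\<lambda>s. f s \<omega>))) =
      of_bool ({1..?K} \<subseteq> range (sizes \<omega>)) * iexp u ^ card (sizes \<omega> -` {2..?K})"
    if "\<omega> \<in> space M" for \<omega>
    using that by (simp add: all_visited_eq[OF assms(2)] indicator_def)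
  then show ?thesis
    using integral_visits_all[of ?K "iexp u"] assms
    by (simp cong: Bochner_Integration.integral_cong)
qed

lemma prob_all_visited:
  assumes "1 \<le> \<xi> n" "nat (\<xi> n) < n"
  shows "complex_of_real (prob (all_visited M n f)) =
    path_gf (image_size_prob n) (nat (\<xi> n)) 1 n"
proof -
  have "complex_of_real (prob (all_visited M n f)) =
      (\<integral>\<omega>. complex_of_real (indicator (all_visited M n f) \<omega>) \<partial>M)"
    using all_visited_event[OF assms(2)] by simp
  then show ?thesis using integral_all_visited[OF assms, of 0] by (simp add: of_real_indicator)
qed

lemma expectation_given_all_visited:
  assumes "1 \<le> \<xi> n" "nat (\<xi> n) < n" "0 < prob (all_visited M n f)"
  shows "expectation_given M (\<lambda>\<omega>. iexp (u * enn2real (T\<^sub>1 n (\<lambda>s. f s \<omega>)))) (all_visited M n f) =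
    path_gf (image_size_prob n) (nat (\<xi> n)) (iexp u) n /
    path_gf (image_size_prob n) (nat (\<xi> n)) 1 n"
proof -
  note measurable_T1[OF assms(2), measurable]
  show ?thesis
    unfolding prob_all_visited[OF assms(1,2), symmetric]
      integral_all_visited[OF assms(1,2), symmetric]
    by (intro expectation_given_eq_divide all_visited_event assms) measurable
qed

end

theorem theorem2:
  fixes M :: "'a measure" and n :: nat and f :: "nat \<Rightarrow> 'a \<Rightarrow> nat \<Rightarrow> nat" and t :: real
  assumes "prob_space M"
    and "n \<ge> 2"
    and "\<xi> n \<ge> 1"
    and "prob_space.indep_vars M (\<lambda>_. count_space (self_maps n)) f {1..}"
    and "\<And>s. s \<ge> 1 \<Longrightarrow>
      distr M (count_space (self_maps n)) (f s) = uniform_count_measure (self_maps n)"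
    and "measure M (all_visited M n f) > 0"
  shows "expectation_given M
      (\<lambda>\<omega>. exp (\<i> * complex_of_real (t * enn2real (T\<^sub>1 n (\<lambda>s. f s \<omega>))))) (all_visited M n f)
    = exp (\<i> * complex_of_real (t * real_of_int (\<xi> n - 1))) *
      (\<Prod>k = 2..nat (\<xi> n).
        (1 - complex_of_real (lam n k)) /
        (1 - complex_of_real (lam n k) * exp (\<i> * complex_of_real t)))"
proof -
  interpret random_self_maps M n f
    using assms by (intro random_self_maps.intro random_self_maps_axioms.intro) auto
  let ?K = "nat (\<xi> n)" and ?z = "iexp t" and ?p = "image_size_prob n"
  have K_less: "?K < n" using assms(2,3) by (rule xi_less)
  have "path_gf ?p ?K 1 n \<noteq> 0"
    using assms(6) by (simp flip: prob_all_visited[OF assms(3) K_less])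
  have "expectation_given M (\<lambda>\<omega>. iexp (t * enn2real (T\<^sub>1 n (\<lambda>s. f s \<omega>)))) (all_visited M n f) =
      path_gf ?p ?K ?z n / path_gf ?p ?K 1 n"
    using assms(3) K_less assms(6) by (rule expectation_given_all_visited)
  also have "\<dots> = ?z ^ (?K - 1) * (\<Prod>k = 2..?K. (1 - complex_of_real (?p k k)) / (1 - ?p k k * ?z))"
    using K_less \<open>path_gf ?p ?K 1 n \<noteq> 0\<close> by (rule path_gf_divide)
  also have "\<dots> = ?z ^ (?K - 1) *
      (\<Prod>k = 2..?K. (1 - complex_of_real (lam n k)) / (1 - lam n k * ?z))"
    using K_less by (simp add: image_size_prob_self)
  also have "?z ^ (?K - 1) = iexp (t * real_of_int (\<xi> n - 1))"
    using assms(3) by (simp add: mult_ac flip: exp_of_nat_mult)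
  finally show ?thesis .
qed

end
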